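(* Let $n\ge2$ and $2\le m\le 2n-1$ be integers, and let $f_1,\ldots,f_m\in\mathbb{C}[z_1,\ldots,z_n]$ be polynomials with $f_j(0)=0$ for all $j$. For every sufficiently small $\varepsilon>0$, a point $p\in S_\varepsilon\setminus K_{f_1f_2\cdots f_m}$ is a singular point of the Milnor fibration product map $\Phi:S_\varepsilon\setminus K_{f_1f_2\cdots f_m}\to T^m$ associated with $f_1,\ldots,f_m$ if and only if the $m+1$ vectors $$p,\ i\,\mathrm{grad}\log f_1(p),\ i\,\mathrm{grad}\log f_2(p),\ \ldots,\ i\,\mathrm{grad}\log f_m(p)$$ are linearly dependent over $\mathbb{R}$.
   Context: $S_\varepsilon=\{z\in\mathbb{C}^n\mid \|z\|=\varepsilon\}$ and $K_{f_1\cdots f_m}=\{z\in S_\varepsilon\mid f_1(z)\cdots f_m(z)=0\}$. The Milnor fibration product map associated with $f_1,\ldots,f_m$ is the $C^\infty$ map $\Phi:S_\varepsilon\setminus K_{f_1\cdots f_m}\to (S^1)^m=T^m$, $\Phi(z)=\left(\frac{f_1(z)}{|f_1(z)|},\ldots,\frac{f_m(z)}{|f_m(z)|}\right)$. A point $p$ is a singular point of $\Phi$ if $\mathrm{rank}\,d\Phi_p<m$. "For every sufficiently small $\varepsilon>0$" means: there is $\varepsilon_0>0$ (depending on the $f_j$) such that the assertion holds for all $0<\varepsilon\le\varepsilon_0$. For holomorphic $h$, $\mathrm{grad}\,h=\left(\overline{\partial h/\partial z_1},\ldots,\overline{\partial h/\partial z_n}\right)$; thus $\mathrm{grad}\log f_j(p)$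 has $k$-th entry $\overline{\frac{1}{f_j(p)}\frac{\partial f_j}{\partial z_k}(p)}$. Linear dependence of a list of vectors refers to the indexed family (repetitions count as dependence). *)

theory Defs
  imports "HOL-Analysis.Analysis" "HOL-Library.Poly_Mapping"
begin

text \<open>
  Polynomials in \<open>\<complex>[z\<^sub>k | k \<in> 'n]\<close> are finitely supported maps from exponent vectors to
  coefficients.
\<close>

type_synonym 'n cpoly = "('n \<Rightarrow>\<^sub>0 nat) \<Rightarrow>\<^sub>0 complex"

definition cpoly_eval :: "('n::finite) cpoly \<Rightarrow> complex ^ 'n \<Rightarrow> complex" where
  "cpoly_eval P z =
     (\<Sum>a\<in>Poly_Mapping.keys P.
        Poly_Mapping.lookup P a * (\<Prod>k\<in>UNIV. (z $ k) ^ Poly_Mapping.lookup a k))"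

definition partial_deriv :: "(complex ^ 'n \<Rightarrow> complex) \<Rightarrow> 'n::finite \<Rightarrow> complex ^ 'n \<Rightarrow> complex" where
  "partial_deriv h k p = deriv (\<lambda>w. h (\<chi> i. if i = k then w else p $ i)) (p $ k)"

text \<open>
  The gradient of \<open>log h\<close> with the convention
  \<open>grad g = (cnj (\<partial>g/\<partial>z\<^sub>1), \<dots>, cnj (\<partial>g/\<partial>z\<^sub>n))\<close>. Near a point with \<open>h p \<noteq> 0\<close> the
  derivatives of \<open>log h\<close> do not depend on the branch of the logarithm.
\<close>

definition grad_log :: "(complex ^ 'n \<Rightarrow> complex) \<Rightarrow> complex ^ 'n \<Rightarrow> complex ^ 'n::finite" where
  "grad_log h p = (\<chi> k. cnj (1 / h p * partial_deriv h k p))"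

text \<open>
  Tangent vectors and differentials are defined through curves. They are meant for an embedded
  submanifold \<open>M\<close> of a Euclidean space and a differentiable map \<open>F\<close> on \<open>M\<close>, with values in
  a Euclidean space or in a submanifold of one (which does not affect the rank). For such \<open>M\<close>
  and \<open>F\<close> the value \<open>(F \<circ> \<gamma>)'(0)\<close> depends only on the velocity \<open>\<gamma>'(0)\<close>.
\<close>

definition curve_in :: "'a::real_normed_vector set \<Rightarrow> 'a \<Rightarrow> 'a \<Rightarrow> (real \<Rightarrow> 'a) \<Rightarrow> bool" where
  "curve_in M p v \<gamma> \<longleftrightarrow>
     (\<exists>e>0. \<gamma> C1_differentiable_on {-e<..<e} \<and> \<gamma> ` {-e<..<e} \<subseteq> M) \<and>
     \<gamma> 0 = p \<and> (\<gamma> has_vector_derivative v) (at 0)"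

definition tangent_space :: "'a::real_normed_vector set \<Rightarrow> 'a \<Rightarrow> 'a set" where
  "tangent_space M p = {v. \<exists>\<gamma>. curve_in M p v \<gamma>}"

definition differential ::
  "'a::real_normed_vector set \<Rightarrow> ('a \<Rightarrow> 'b::real_normed_vector) \<Rightarrow> 'a \<Rightarrow> 'a \<Rightarrow> 'b" where
  "differential M F p v =
     (THE w. \<forall>\<gamma>. curve_in M p v \<gamma> \<longrightarrow> ((F \<circ> \<gamma>) has_vector_derivative w) (at 0))"

definition rank_differential ::
  "'a::real_normed_vector set \<Rightarrow> ('a \<Rightarrow> 'b::real_normed_vector) \<Rightarrow> 'a \<Rightarrow> nat" where
  "rank_differential M F p = dim (differential M F p ` tangent_space M p)"

definition link :: "('m::finite \<Rightarrow> complex ^ 'n \<Rightarrow> complex) \<Rightarrow> real \<Rightarrow> (complex ^ 'n::finite) set" where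
  "link f \<epsilon> = {z \<in> sphere 0 \<epsilon>. (\<Prod>j\<in>UNIV. f j z) = 0}"

definition torus :: "(complex ^ 'm::finite) set" where
  "torus = {w. \<forall>j. w $ j \<in> sphere 0 1}"

definition milnor_product_map ::
  "('m::finite \<Rightarrow> complex ^ 'n::finite \<Rightarrow> complex) \<Rightarrow> complex ^ 'n \<Rightarrow> complex ^ 'm" where
  "milnor_product_map f z = (\<chi> j. f j z / complex_of_real (cmod (f j z)))"

lemma milnor_product_map_in_torus:
  "milnor_product_map f \<in> (sphere 0 \<epsilon> - link f \<epsilon>) \<rightarrow> torus"
  by (auto simp: milnor_product_map_def torus_def link_def norm_divide)

definition singular_point ::
  "('m::finite \<Rightarrow> complex ^ 'n::finite \<Rightarrow> complex) \<Rightarrow> real \<Rightarrow> complex ^ 'n \<Rightarrow> bool" where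
  "singular_point f \<epsilon> p \<longleftrightarrow>
     rank_differential (sphere 0 \<epsilon> - link f \<epsilon>) (milnor_product_map f) p < CARD('m)"

text \<open>
  Linear dependence over \<open>\<real>\<close> of an indexed family. The library's \<^const>\<open>dependent\<close> is about
  sets and so would ignore repetitions.
\<close>

definition dependent_family :: "('i::finite \<Rightarrow> 'a::real_vector) \<Rightarrow> bool" where
  "dependent_family v \<longleftrightarrow> (\<exists>c :: 'i \<Rightarrow> real. (\<exists>i. c i \<noteq> 0) \<and> (\<Sum>i\<in>UNIV. c i *\<^sub>R v i) = 0)"

text \<open>
  The family \<open>p, i grad log f\<^sub>1(p), \<dots>, i grad log f\<^sub>m(p)\<close>, with index \<^const>\<open>None\<close> for \<open>p\<close>.
\<close>

definition point_and_grad_logs ::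
  "('m::finite \<Rightarrow> complex ^ 'n::finite \<Rightarrow> complex) \<Rightarrow> complex ^ 'n \<Rightarrow> 'm option \<Rightarrow> complex ^ 'n" where
  "point_and_grad_logs f p = case_option p (\<lambda>j. \<i> *s grad_log (f j) p)"

end

theory Submission
  imports Defs
begin

text \<open>
  Write \<open>u\<^sub>j = i grad log f\<^sub>j(p)\<close>. The differential of \<open>f\<^sub>j / |f\<^sub>j|\<close> at \<open>p\<close> sends \<open>v\<close> to
  \<open>i (v \<bullet> u\<^sub>j) f\<^sub>j(p) / |f\<^sub>j(p)|\<close>, where \<open>\<bullet>\<close> is the real inner product of \<open>\<complex>\<^sup>n\<close>, and the tangent
  space of the sphere at \<open>p\<close> is the real hyperplane orthogonal to \<open>p\<close>. So the rank is less than
  \<open>m\<close> iff some nonzero real \<open>c\<close> makes \<open>\<Sum>\<^sub>j c\<^sub>j u\<^sub>j\<close> orthogonal to this hyperplane, that is, a real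
  multiple of \<open>p\<close>.
\<close>

section \<open>Linear algebra: the rank of a family of functionals on a hyperplane\<close>

text \<open>Subtracting from \<open>w\<close> its projection to the line of \<open>p\<close> leaves
  a vector orthogonal to \<open>p\<close>, hence by assumption to \<open>w\<close>, hence to
  itself.\<close>

lemma proportional_if_orthogonal_complement:
  fixes p w :: "'a::real_inner"
  assumes "\<And>v. p \<bullet> v = 0 \<Longrightarrow> v \<bullet> w = 0"
  obtains c where "w = c *\<^sub>R p"
proof (cases "p = 0")
  case True
  then have "w = 0" using assms[of w] by simp
  then show ?thesis using that[of 0] by simp
next
  case False
  define c where "c = (p \<bullet> w) / (p \<bullet> p)"
  define v where "v = w - c *\<^sub>R p"
  have pv: "p \<bullet> v = 0"
    using False by (simp add: v_def c_def inner_diff_right)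
  have "v \<bullet> v = v \<bullet> w - c * (p \<bullet> v)"
    by (simp add: v_def inner_diff_right inner_diff_left inner_commute algebra_simps)
  then have "v = 0" using pv assms[OF pv] by simp
  then show ?thesis using that[of c] by (simp add: v_def)
qed

text \<open>As \<open>p \<noteq> 0\<close>, a nontrivial relation cannot involve \<open>p\<close>
  alone, so the term in \<open>p\<close> can be moved to the other side.\<close>

lemma dependent_family_case_option:
  fixes u :: "'m::finite \<Rightarrow> 'a::real_vector"
  assumes "p \<noteq> 0"
  shows "dependent_family (case_option p u) \<longleftrightarrow>
    (\<exists>c a. (\<exists>j. c j \<noteq> 0) \<and> (\<Sum>j\<in>UNIV. c j *\<^sub>R u j) = a *\<^sub>R p)"
proof -
  have sum_option: "(\<Sum>i\<in>UNIV. c i *\<^sub>R case_option p u i) =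
      c None *\<^sub>R p + (\<Sum>j\<in>UNIV. c (Some j) *\<^sub>R u j)" for c :: "'m option \<Rightarrow> real"
    by (simp add: UNIV_option_conv sum.reindex)
  show ?thesis
  proof
    assume "dependent_family (case_option p u)"
    then obtain c :: "'m option \<Rightarrow> real" and i where i: "c i \<noteq> 0"
      and c: "c None *\<^sub>R p + (\<Sum>j\<in>UNIV. c (Some j) *\<^sub>R u j) = 0"
      unfolding dependent_family_def sum_option by blast
    have "\<exists>j. c (Some j) \<noteq> 0"
    proof (rule ccontr)
      assume "\<not> ?thesis"
      then show False using c i assms by (cases i) simp_all
    qed
    moreover have "(\<Sum>j\<in>UNIV. c (Some j) *\<^sub>R u j) = (- c None) *\<^sub>R p"
      using c by (simp add: add_eq_0_iff)
    ultimately show "\<exists>c a. (\<exists>j. c j \<noteq> 0) \<and> (\<Sum>j\<in>UNIV. c j *\<^sub>R u j) = a *\<^sub>R p"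
      by (intro exI[of _ "\<lambda>j. c (Some j)"] exI[of _ "- c None"]) simp
  next
    assume "\<exists>c a. (\<exists>j. c j \<noteq> 0) \<and> (\<Sum>j\<in>UNIV. c j *\<^sub>R u j) = a *\<^sub>R p"
    then obtain c a j where "c j \<noteq> 0" "(\<Sum>j\<in>UNIV. c j *\<^sub>R u j) = a *\<^sub>R p" by blast
    then show "dependent_family (case_option p u)"
      unfolding dependent_family_def sum_option
      by (intro exI[of _ "case_option (- a) c"]) (auto intro: exI[of _ "Some j"])
  qed
qed

text \<open>The image is a proper subspace iff a nonzero \<open>c\<close> annihilates it. The
  adjoint identity \<open>inner_S\<close> turns this into orthogonality of a combination of the
  \<open>u j\<close> to the hyperplane.\<close>

lemma dim_inner_image_less_iff_dependent_family:
  fixes u :: "'m::finite \<Rightarrow> 'a::real_inner"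
  assumes "p \<noteq> 0"
  shows "dim ((\<lambda>v. \<chi> j. v \<bullet> u j :: real^'m) ` {v. p \<bullet> v = 0}) < CARD('m) \<longleftrightarrow>
    dependent_family (case_option p u)"
proof -
  define S where "S = (\<lambda>v. \<chi> j. v \<bullet> u j :: real^'m) ` {v. p \<bullet> v = 0}"
  have inner_S: "c \<bullet> (\<chi> j. v \<bullet> u j) = v \<bullet> (\<Sum>j\<in>UNIV. c $ j *\<^sub>R u j)" for c :: "real^'m" and v
    by (simp add: inner_vec_def inner_sum_right)
  have "dim S < CARD('m) \<longleftrightarrow> (\<exists>c. c \<noteq> 0 \<and> (\<forall>x\<in>S. c \<bullet> x = 0))"
  proof
    assume "dim S < CARD('m)"
    then obtain c where "c \<noteq> 0" "\<And>y. y \<in> span S \<Longrightarrow> orthogonal c y"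
      using orthogonal_to_subspace_exists[of S] by auto
    then show "\<exists>c. c \<noteq> 0 \<and> (\<forall>x\<in>S. c \<bullet> x = 0)"
      by (auto simp: orthogonal_def span_base)
  next
    assume "\<exists>c. c \<noteq> 0 \<and> (\<forall>x\<in>S. c \<bullet> x = 0)"
    then obtain c where c: "c \<noteq> 0" "S \<subseteq> {x. c \<bullet> x = 0}" by blast
    have "dim S \<le> CARD('m) - 1"
      using dim_subset[OF c(2)] dim_hyperplane[OF c(1)] by simp
    then show "dim S < CARD('m)"
      \<comment> \<open>The difference \<open>CARD('m) - 1\<close> is truncated, so strictness needs
        a positive cardinality.\<close>
      using zero_less_card_finite[where 'a='m] by linarith
  qed
  also have "\<dots> \<longleftrightarrow> (\<exists>c :: real^'m. c \<noteq> 0 \<and> (\<exists>a. (\<Sum>j\<in>UNIV. c $ j *\<^sub>R u j) = a *\<^sub>R p))"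
  proof -
    have "(\<forall>x\<in>S. c \<bullet> x = 0) \<longleftrightarrow> (\<exists>a. (\<Sum>j\<in>UNIV. c $ j *\<^sub>R u j) = a *\<^sub>R p)" for c
    proof
      assume "\<forall>x\<in>S. c \<bullet> x = 0"
      then have "v \<bullet> (\<Sum>j\<in>UNIV. c $ j *\<^sub>R u j) = 0" if "p \<bullet> v = 0" for v
        using that by (auto simp: S_def inner_S)
      then obtain a where "(\<Sum>j\<in>UNIV. c $ j *\<^sub>R u j) = a *\<^sub>R p"
        by (rule proportional_if_orthogonal_complement)
      then show "\<exists>a. (\<Sum>j\<in>UNIV. c $ j *\<^sub>R u j) = a *\<^sub>R p" ..
    next
      assume "\<exists>a. (\<Sum>j\<in>UNIV. c $ j *\<^sub>R u j) = a *\<^sub>R p"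
      then show "\<forall>x\<in>S. c \<bullet> x = 0"
        by (auto simp: S_def inner_S inner_commute)
    qed
    then show ?thesis by simp
  qed
  also have "\<dots> \<longleftrightarrow> dependent_family (case_option p u)"
  proof -
    \<comment> \<open>Annihilators are vectors, whereas \<open>dependent_family\<close> takes
      coefficient functions.\<close>
    have ex_vec: "(\<exists>c :: real^'m. P (($) c)) \<longleftrightarrow> (\<exists>c. P c)" for P
    proof
      assume "\<exists>c. P c"
      then obtain c where "P c" ..
      then have "P (($) (\<chi> j. c j))" by (simp add: vec_lambda_inverse)
      then show "\<exists>c :: real^'m. P (($) c)" ..
    qed blast
    show ?thesis
      unfolding dependent_family_case_option[OF assms] vec_eq_iff zero_index
      using ex_vec[of "\<lambda>c. (\<exists>j. c j \<noteq> 0) \<and> (\<exists>a. (\<Sum>j\<in>UNIV. c j *\<^sub>R u j) = a *\<^sub>R p)"]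
      by simp
  qed
  finally show ?thesis unfolding S_def .
qed

section \<open>Differentials, and tangent spaces of open parts of spheres\<close>

lemma curve_in_vector_derivative:
  assumes "curve_in M p v \<gamma>" and "(F has_derivative L) (at p)"
  shows "((F \<circ> \<gamma>) has_vector_derivative L v) (at 0)"
proof -
  have "(\<gamma> has_vector_derivative v) (at 0)" and "\<gamma> 0 = p"
    using assms(1) by (auto simp: curve_in_def)
  then show ?thesis
    using vector_derivative_diff_chain_within[of \<gamma> v 0 UNIV F L] assms(2)
    by (auto intro: has_derivative_at_withinI)
qed

text \<open>The chain rule shows that \<open>L v\<close> satisfies the definite description.
  Uniqueness needs at least one curve with velocity \<open>v\<close>, which membership in the
  tangent space supplies.\<close>

lemma differential_eq_derivative:
  assumes "(F has_derivative L) (at p)" and "v \<in> tangent_space M p"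
  shows "differential M F p v = L v"
  unfolding differential_def
proof (rule the_equality)
  show "\<forall>\<gamma>. curve_in M p v \<gamma> \<longrightarrow> ((F \<circ> \<gamma>) has_vector_derivative L v) (at 0)"
    using curve_in_vector_derivative[OF _ assms(1)] by blast
next
  fix w
  assume w: "\<forall>\<gamma>. curve_in M p v \<gamma> \<longrightarrow> ((F \<circ> \<gamma>) has_vector_derivative w) (at 0)"
  obtain \<gamma> where \<gamma>: "curve_in M p v \<gamma>"
    using assms(2) by (auto simp: tangent_space_def)
  show "w = L v"
    using vector_derivative_unique_at w \<gamma> curve_in_vector_derivative[OF \<gamma> assms(1)] by blast
qed

text \<open>Near 0 the squared norm of the curve is constant, and its derivative at 0 is twice
  \<open>p \<bullet> v\<close>.\<close>

lemma curve_in_sphere_orthogonal: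
  fixes p :: "'a::real_inner"
  assumes "curve_in M p v \<gamma>" and "M \<subseteq> sphere 0 r"
  shows "p \<bullet> v = 0"
proof -
  obtain e where e: "e > 0" "\<gamma> ` {-e<..<e} \<subseteq> M"
    and \<gamma>: "\<gamma> 0 = p" "(\<gamma> has_vector_derivative v) (at 0)"
    using assms(1) by (auto simp: curve_in_def)
  have norm_\<gamma>: "\<gamma> t \<bullet> \<gamma> t = r\<^sup>2" if "t \<in> {-e<..<e}" for t
    using e(2) that assms(2) by (force simp: power2_norm_eq_inner[symmetric])
  have "((\<lambda>t. \<gamma> t \<bullet> \<gamma> t) has_derivative (\<lambda>t. \<gamma> 0 \<bullet> (t *\<^sub>R v) + (t *\<^sub>R v) \<bullet> \<gamma> 0)) (at 0)"
    by (rule has_derivative_inner; use \<gamma> in \<open>simp add: has_vector_derivative_def\<close>)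
  moreover have "((\<lambda>t. \<gamma> t \<bullet> \<gamma> t) has_derivative (\<lambda>t. 0)) (at 0)"
    by (rule has_derivative_transform_within_open[of "\<lambda>t. r\<^sup>2" _ _ _ "{-e<..<e}"])
      (use e(1) norm_\<gamma> in auto)
  ultimately have "(\<lambda>t. \<gamma> 0 \<bullet> (t *\<^sub>R v) + (t *\<^sub>R v) \<bullet> \<gamma> 0) = (\<lambda>t. 0)"
    by (rule has_derivative_unique)
  from fun_cong[OF this, of 1] show ?thesis
    by (simp add: \<gamma>(1) inner_commute)
qed

text \<open>Conversely to the previous lemma, every \<open>v\<close> orthogonal to \<open>p\<close>
  is the velocity of a great circle through \<open>p\<close>, which stays in \<open>U\<close> for a
  short time.\<close>

lemma tangent_space_open_in_sphere:
  fixes p :: "'a::real_inner"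
  assumes "open U" and "p \<in> U" and "norm p = r" and "r > 0"
  shows "tangent_space (sphere 0 r \<inter> U) p = {v. p \<bullet> v = 0}"
proof (intro equalityI subsetI)
  fix v assume "v \<in> tangent_space (sphere 0 r \<inter> U) p"
  then show "v \<in> {v. p \<bullet> v = 0}"
    using curve_in_sphere_orthogonal[of "sphere 0 r \<inter> U"] by (auto simp: tangent_space_def)
next
  fix v assume "v \<in> {v. p \<bullet> v = 0}"
  then have pv: "p \<bullet> v = 0" by simp
  define s where "s = norm v / r"
  define w where "w = v /\<^sub>R s" \<comment> \<open>\<open>w = 0\<close> if \<open>v = 0\<close>, as division by zero gives zero\<close>
  \<comment> \<open>For \<open>v \<noteq> 0\<close>, \<open>w\<close> is orthogonal to
    \<open>p\<close> and also of norm \<open>r\<close>, so this is a great circle of angular speed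
    \<open>s\<close>, with velocity \<open>s *\<^sub>R w = v\<close> at 0.\<close>
  define \<gamma> where "\<gamma> = (\<lambda>t. cos (s * t) *\<^sub>R p + sin (s * t) *\<^sub>R w)"
  define \<gamma>' where "\<gamma>' = (\<lambda>t. (- s * sin (s * t)) *\<^sub>R p + (s * cos (s * t)) *\<^sub>R w)"
  have deriv: "(\<gamma> has_vector_derivative \<gamma>' t) (at t)" for t
    unfolding \<gamma>_def \<gamma>'_def
    by (auto intro!: derivative_eq_intros simp: algebra_simps)
  have cont: "continuous_on A \<gamma>'" for A
    unfolding \<gamma>'_def by (intro continuous_intros)
  have sphere: "norm (\<gamma> t) = r" for t
  proof (cases "v = 0")
    case True
    then show ?thesis using assms by (simp add: \<gamma>_def s_def w_def)
  next
    case False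
    have pw: "p \<bullet> w = 0" using pv by (simp add: w_def)
    have "norm w = r" using False assms(4) by (simp add: w_def s_def)
    then have "(norm (\<gamma> t))\<^sup>2 = (cos (s * t))\<^sup>2 * r\<^sup>2 + (sin (s * t))\<^sup>2 * r\<^sup>2"
      using assms(3)
      by (simp add: \<gamma>_def norm_add_Pythagorean orthogonal_def pw power_mult_distrib)
    also have "\<dots> = r\<^sup>2" by (simp flip: distrib_right)
    finally show ?thesis using assms(4) by simp
  qed
  have \<gamma>0: "\<gamma> 0 = p" by (simp add: \<gamma>_def)
  have "continuous_on UNIV \<gamma>" unfolding \<gamma>_def by (intro continuous_intros)
  then have "open (\<gamma> -` U)" by (simp add: assms(1) open_vimage)
  moreover have "0 \<in> \<gamma> -` U" using \<gamma>0 assms(2) by simp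
  ultimately obtain e where e: "e > 0" "ball 0 e \<subseteq> \<gamma> -` U"
    by (meson open_contains_ball)
  have "\<gamma> ` {-e<..<e} \<subseteq> sphere 0 r \<inter> U"
    using e(2) sphere by (auto simp: ball_eq_greaterThanLessThan)
  moreover have "\<gamma> C1_differentiable_on {-e<..<e}"
    unfolding C1_differentiable_on_def using deriv cont by blast
  moreover have "(\<gamma> has_vector_derivative v) (at 0)"
    using deriv[of 0] assms(4) by (cases "v = 0") (simp_all add: \<gamma>'_def w_def s_def)
  ultimately show "v \<in> tangent_space (sphere 0 r \<inter> U) p"
    using e(1) \<gamma>0 by (auto simp: tangent_space_def curve_in_def)
qed

section \<open>Real derivatives of polynomials and of their normalisations to the unit
  circle\<close>

text \<open>The basis vectors are \<open>axis i b\<close> with \<open>b\<close> in the basis of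
  \<open>'b\<close>, so each coordinate is one of a single component \<open>f i\<close>.\<close>

lemma has_derivative_vec_lambda:
  fixes f :: "'i::finite \<Rightarrow> 'a::real_normed_vector \<Rightarrow> 'b::euclidean_space"
  assumes "\<And>i. (f i has_derivative L i) (at x within S)"
  shows "((\<lambda>x. \<chi> i. f i x) has_derivative (\<lambda>v. \<chi> i. L i v)) (at x within S)"
  unfolding has_derivative_componentwise_within[where f = "\<lambda>x. \<chi> i. f i x"]
  using assms by (auto simp: Basis_vec_def inner_axis intro!: has_derivative_inner_left)

text \<open>Complex linearity makes \<open>h\<close> complex differentiable along each coordinate
  line, with derivative \<open>L (axis k 1)\<close>. Expanding \<open>v\<close> in the standard
  basis then gives the sum.\<close>

lemma complex_linear_derivative_eq_partial_derivs:
  fixes h :: "complex ^ 'n::finite \<Rightarrow> complex"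
  assumes h: "(h has_derivative L) (at p)" and L: "\<And>c v. L (c *s v) = c * L v"
  shows "L v = (\<Sum>k\<in>UNIV. partial_deriv h k p * v $ k)"
proof -
  have partial: "partial_deriv h k p = L (axis k 1)" for k
  proof -
    define \<phi> :: "complex \<Rightarrow> complex ^ 'n" where "\<phi> = (\<lambda>w. \<chi> i. if i = k then w else p $ i)"
    have "(\<phi> has_derivative (\<lambda>w. \<chi> i. if i = k then w else 0)) (at (p $ k))"
      unfolding \<phi>_def
    proof (rule has_derivative_vec_lambda)
      show "((\<lambda>w. if i = k then w else p $ i) has_derivative (\<lambda>w. if i = k then w else 0)) (at (p $ k))"
        for i by (cases "i = k") simp_all
    qed
    moreover have "(\<lambda>w :: complex. \<chi> i. if i = k then w else 0) = (\<lambda>w. w *s axis k 1)"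
      by (auto simp: fun_eq_iff vec_eq_iff axis_def)
    ultimately have "(\<phi> has_derivative (\<lambda>w. w *s axis k 1)) (at (p $ k))"
      by simp
    moreover have "\<phi> (p $ k) = p" by (simp add: \<phi>_def vec_eq_iff)
    ultimately have "((\<lambda>w. h (\<phi> w)) has_derivative (\<lambda>w. L (w *s axis k 1))) (at (p $ k))"
      using h by (intro has_derivative_compose[of \<phi> _ "p $ k" UNIV h L]) auto
    then have "((\<lambda>w. h (\<phi> w)) has_field_derivative L (axis k 1)) (at (p $ k))"
      unfolding has_field_derivative_def L by (simp only: mult_commute_abs)
    then show ?thesis
      unfolding partial_deriv_def \<phi>_def by (rule DERIV_imp_deriv)
  qed
  have lin: "linear L" using h by (rule has_derivative_linear)
  have "v = (\<Sum>k\<in>UNIV. v $ k *s axis k 1)"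
    by (simp add: basis_expansion)
  then have "L v = (\<Sum>k\<in>UNIV. L (v $ k *s axis k 1))"
    using linear_sum[OF lin] by metis
  then show ?thesis by (simp add: L partial mult.commute)
qed

text \<open>The product rule gives some derivative \<open>L\<close>. It is complex linear, so the
  previous lemma identifies it without computing any partial derivative.\<close>

lemma has_derivative_cpoly_eval:
  "(cpoly_eval P has_derivative (\<lambda>v. \<Sum>k\<in>UNIV. partial_deriv (cpoly_eval P) k p * v $ k)) (at p)"
proof -
  \<comment> \<open>For exponent 0 the truncated \<open>Poly_Mapping.lookup a k - 1\<close> does no
    harm, since the factor \<open>of_nat\<close> vanishes.\<close>
  define L where "L = (\<lambda>v. \<Sum>a\<in>Poly_Mapping.keys P. Poly_Mapping.lookup P a *
    (\<Sum>k\<in>UNIV. of_nat (Poly_Mapping.lookup a k) * v $ k * (p $ k) ^ (Poly_Mapping.lookup a k - 1) *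
       (\<Prod>l\<in>UNIV - {k}. (p $ l) ^ Poly_Mapping.lookup a l)))"
  have L: "(cpoly_eval P has_derivative L) (at p)"
    unfolding cpoly_eval_def L_def
    by (auto intro!: derivative_eq_intros has_derivative_prod bounded_linear_imp_has_derivative
        bounded_linear_vec_nth)
  moreover have "\<And>c v. L (c *s v) = c * L v"
    by (simp add: L_def sum_distrib_left mult_ac)
  ultimately have "L = (\<lambda>v. \<Sum>k\<in>UNIV. partial_deriv (cpoly_eval P) k p * v $ k)"
    by (intro ext complex_linear_derivative_eq_partial_derivs)
  with L show ?thesis by simp
qed

text \<open>The inner product is the real part of the Hermitian product, whose conjugation cancels
  the one in \<open>grad_log\<close> and turns \<open>\<i>\<close> into \<open>-\<i>\<close>; and
  \<open>Re (-\<i> * x) = Im x\<close>.\<close>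

lemma inner_times_i_grad_log:
  "v \<bullet> (\<i> *s grad_log h p) = Im ((\<Sum>k\<in>UNIV. partial_deriv h k p * v $ k) / h p)"
proof -
  have "v \<bullet> (\<i> *s grad_log h p) = (\<Sum>k\<in>UNIV. Im (partial_deriv h k p * v $ k / h p))"
    unfolding inner_vec_def
    by (intro sum.cong refl) (simp add: grad_log_def inner_complex_def Re_divide Im_divide
        add_divide_distrib diff_divide_distrib algebra_simps)
  then show ?thesis by (simp add: sum_divide_distrib)
qed

text \<open>Locally the quotient is the exponential of \<open>\<i>\<close> times an argument of
  \<open>g\<close>, and the argument has derivative \<open>Im (L v / g p)\<close>.\<close>

lemma has_derivative_divide_cmod:
  fixes g :: "'a::real_normed_vector \<Rightarrow> complex"
  assumes g: "(g has_derivative L) (at p)" and nz: "g p \<noteq> 0"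
  shows "((\<lambda>z. g z / complex_of_real (cmod (g z))) has_derivative
    (\<lambda>v. \<i> * complex_of_real (Im (L v / g p)) * (g p / complex_of_real (cmod (g p))))) (at p)"
proof -
  have "((\<lambda>z. cmod (g z)) has_derivative (\<lambda>v. L v \<bullet> sgn (g p))) (at p)"
    using has_derivative_compose[OF g has_derivative_norm[OF nz]] by simp
  then have "((\<lambda>z. g z / complex_of_real (cmod (g z))) has_derivative
    (\<lambda>v. - g p * (inverse (complex_of_real (cmod (g p))) * complex_of_real (L v \<bullet> sgn (g p)) *
          inverse (complex_of_real (cmod (g p)))) + L v / complex_of_real (cmod (g p)))) (at p)"
    by (intro has_derivative_divide g has_derivative_of_real) (use nz in auto)
  moreover have "- g p * (inverse (complex_of_real (cmod (g p))) * complex_of_real (L v \<bullet> sgn (g p)) *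
          inverse (complex_of_real (cmod (g p)))) + L v / complex_of_real (cmod (g p)) =
        \<i> * complex_of_real (Im (L v / g p)) * (g p / complex_of_real (cmod (g p)))" for v
  proof -
    define r where "r = cmod (g p)"
    \<comment> \<open>\<open>w\<close> is the logarithmic derivative. Its real part, the radial
      change, cancels against the derivative of the modulus.\<close>
    define w where "w = L v / g p"
    have Lv: "L v = g p * w" using nz by (simp add: w_def)
    have r: "r \<noteq> 0" using nz by (simp add: r_def)
    have "L v \<bullet> g p = r\<^sup>2 * Re w"
      unfolding Lv r_def cmod_power2 by (simp add: inner_complex_def power2_eq_square algebra_simps)
    then have "L v \<bullet> sgn (g p) = r * Re w"
      using r by (simp add: sgn_div_norm r_def[symmetric] power2_eq_square)
    moreover have "g p * w = g p * complex_of_real (Re w) + \<i> * (g p * complex_of_real (Im w))"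
      by (simp add: complex_eq_iff algebra_simps)
    ultimately show ?thesis
      unfolding w_def[symmetric] r_def[symmetric]
      unfolding Lv using r
      by (simp add: field_simps)
  qed
  ultimately show ?thesis by simp
qed

text \<open>Each component is a real multiple of a fixed unit tangent vector of the circle, so the
  real coefficients determine the rank.\<close>

lemma has_derivative_milnor_product_map:
  fixes f :: "'m::finite \<Rightarrow> 'n::finite cpoly"
  assumes "\<And>j. cpoly_eval (f j) p \<noteq> 0"
  shows "(milnor_product_map (\<lambda>j. cpoly_eval (f j)) has_derivative
    (\<lambda>v. \<chi> j. \<i> * complex_of_real (v \<bullet> (\<i> *s grad_log (cpoly_eval (f j)) p)) *
       milnor_product_map (\<lambda>j. cpoly_eval (f j)) p $ j)) (at p)"
  unfolding milnor_product_map_def[abs_def] inner_times_i_grad_log vec_lambda_beta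
  by (intro has_derivative_vec_lambda has_derivative_divide_cmod has_derivative_cpoly_eval assms)

section \<open>The rank of the differential of the product map\<close>

theorem lemma5p1:
  fixes f :: "'m::finite \<Rightarrow> ('n::finite) cpoly"
  assumes "2 \<le> CARD('n)"
    and "2 \<le> CARD('m)" and "CARD('m) \<le> 2 * CARD('n) - 1"
    and "\<And>j. cpoly_eval (f j) 0 = 0"
  shows "\<exists>\<epsilon>\<^sub>0>0. \<forall>\<epsilon>. 0 < \<epsilon> \<and> \<epsilon> \<le> \<epsilon>\<^sub>0 \<longrightarrow>
           (\<forall>p \<in> sphere 0 \<epsilon> - link (\<lambda>j. cpoly_eval (f j)) \<epsilon>.
              singular_point (\<lambda>j. cpoly_eval (f j)) \<epsilon> p \<longleftrightarrow>
              dependent_family (point_and_grad_logs (\<lambda>j. cpoly_eval (f j)) p))"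
proof -
  define F where "F = (\<lambda>j. cpoly_eval (f j))"
  have "singular_point F \<epsilon> p \<longleftrightarrow> dependent_family (point_and_grad_logs F p)"
    if \<epsilon>: "0 < \<epsilon>" and p: "p \<in> sphere 0 \<epsilon> - link F \<epsilon>" for \<epsilon> p
  proof -
    define M where "M = sphere 0 \<epsilon> - link F \<epsilon>"
    define U where "U = {z. (\<Prod>j\<in>UNIV. F j z) \<noteq> 0}"
    define u where "u = (\<lambda>j. \<i> *s grad_log (F j) p)"
    \<comment> \<open>The differential factors as \<open>A\<close> after \<open>B\<close>:
      \<open>B\<close> gives the angular velocities, and \<open>A\<close> places them in the tangent
      space of the torus.\<close>
    define A :: "real ^ 'm \<Rightarrow> complex ^ 'm" where
      "A = (\<lambda>x. \<chi> j. \<i> * complex_of_real (x $ j) * milnor_product_map F p $ j)"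
    define B :: "complex ^ 'n \<Rightarrow> real ^ 'm" where "B = (\<lambda>v. \<chi> j. v \<bullet> u j)"
    have norm_p: "norm p = \<epsilon>" and "p \<in> U" using p by (auto simp: link_def U_def)
    then have F_nz: "F j p \<noteq> 0" for j by (auto simp: U_def)
    have M_eq: "M = sphere 0 \<epsilon> \<inter> U" by (auto simp: M_def U_def link_def)
    have "continuous_on UNIV (F j)" for j
      unfolding F_def
      by (meson has_derivative_cpoly_eval has_derivative_continuous continuous_at_imp_continuous_on)
    then have "open U"
      unfolding U_def by (intro open_Collect_neq continuous_intros)
    then have tangent: "tangent_space M p = {v. p \<bullet> v = 0}"
      unfolding M_eq using \<open>p \<in> U\<close> norm_p \<epsilon> by (rule tangent_space_open_in_sphere)
    have "(milnor_product_map F has_derivative (\<lambda>v. A (B v))) (at p)"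
      using has_derivative_milnor_product_map[of f p] F_nz
      by (simp add: F_def A_def B_def u_def)
    then have "differential M (milnor_product_map F) p ` tangent_space M p = A ` B ` {v. p \<bullet> v = 0}"
      by (force simp: tangent image_image differential_eq_derivative intro!: image_cong)
    \<comment> \<open>\<open>A\<close> is injective because no component of the product map vanishes
      at \<open>p\<close>, so it preserves dimension.\<close>
    moreover have "dim (A ` B ` {v. p \<bullet> v = 0}) = dim (B ` {v. p \<bullet> v = 0})"
    proof (rule dim_image_eq)
      show "linear A"
        by (rule linearI) (auto simp: A_def vec_eq_iff algebra_simps scaleR_conv_of_real[where 'a = complex])
      show "inj_on A (span (B ` {v. p \<bullet> v = 0}))"
        using F_nz by (auto simp: inj_on_def A_def vec_eq_iff milnor_product_map_def)
    qed
    moreover have "p \<noteq> 0" using norm_p \<epsilon> by auto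
    ultimately show ?thesis
      using dim_inner_image_less_iff_dependent_family[of p u]
      by (simp add: singular_point_def rank_differential_def M_def B_def u_def
          point_and_grad_logs_def)
  qed
  \<comment> \<open>The equivalence was shown for every positive radius, so 1 is an arbitrary
    choice.\<close>
  then show ?thesis
    unfolding F_def by (intro exI[of _ 1] conjI allI impI ballI zero_less_one) (elim conjE)
qed

end
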